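(* Let $m,n\ge 2$ be integers and let $\beta\in[0,1)$. There exists a convex and Lipschitz function $f:\mathbb{R}^{m\times n}\to\mathbb{R}$ such that the following holds. Let $\{\phi_t\}_{t\ge0}$ be any adaptive step-size rule, i.e. any sequence of functions $\phi_t:(\mathbb{R}^{m\times n})^{t+1}\to[0,+\infty)$. Then for Lebesgue-almost every $W_0\in\mathbb{R}^{m\times n}$, every sequence $\{W_t\}_{t\ge0}$ generated from $W_0$ by the exact Muon recursion with constant momentum factor $\beta$, namely $$G_t\in\partial f(W_t),\qquad M_0=G_0,\qquad M_{t+1}=\beta M_t+(1-\beta)G_t,\qquad W_{t+1}=W_t-\eta_t P_{t+1},\qquad \eta_t=\phi_t(G_0,\dots,G_t),$$ where $P_{t+1}$ is the orthogonal (polar) factor of $M_{t+1}$, satisfies $$\inf_{t\ge0} f(W_t)>f^\star:=\inf_{W\in\mathbb{R}^{m\times n}}f(W).$$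
   Context: For a matrix $M\in\mathbb{R}^{m\times n}$, $M\neq 0$, with compact singular value decomposition $M=U\Sigma V^\top$ (with $\Sigma$ a $\operatorname{rank}(M)\times\operatorname{rank}(M)$ positive diagonal matrix), its orthogonal (polar) factor is $UV^\top$, which does not depend on the choice of compact SVD; the orthogonal factor of $M=0$ is $0$. $\partial f$ denotes the convex subdifferential of $f$ with respect to the Frobenius inner product. *)

theory Defs
  imports "HOL-Analysis.Analysis"
begin

text \<open>
  An \<open>m \<times> n\<close> real matrix has type \<^typ>\<open>real ^ 'n ^ 'm\<close>; the library's inner product
  and norm on this type are the Frobenius ones.
\<close>

definition subdifferential :: "('a::real_inner \<Rightarrow> real) \<Rightarrow> 'a \<Rightarrow> 'a set" where
  "subdifferential f x = {g. \<forall>y. f y \<ge> f x + g \<bullet> (y - x)}"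

text \<open>
  The number of columns of the factors of a compact singular value decomposition depends on
  the matrix, so they cannot be given a matrix type. They are families of columns \<open>u k\<close>, \<open>v k\<close>
  and diagonal entries \<open>s k\<close>, of which only the indices \<open>k < rank A\<close> matter. The last
  conjunct is \<open>A = U \<Sigma> V\<^sup>T\<close> written entrywise; the conjuncts before it are
  \<open>U\<^sup>T U = I\<close>, \<open>V\<^sup>T V = I\<close> and positivity of the diagonal.
\<close>

definition compact_svd ::
    "real ^ 'n ^ 'm \<Rightarrow> (nat \<Rightarrow> real ^ 'm) \<Rightarrow> (nat \<Rightarrow> real) \<Rightarrow> (nat \<Rightarrow> real ^ 'n) \<Rightarrow> bool" where
  "compact_svd A u s v \<longleftrightarrow>
     (\<forall>k<rank A. s k > 0) \<and>
     (\<forall>k<rank A. \<forall>l<rank A. u k \<bullet> u l = (if k = l then 1 else 0)) \<and>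
     (\<forall>k<rank A. \<forall>l<rank A. v k \<bullet> v l = (if k = l then 1 else 0)) \<and>
     A = (\<chi> i j. \<Sum>k<rank A. u k $ i * s k * v k $ j)"

text \<open>
  \<open>is_polar_factor A P\<close>: \<open>P\<close> is the orthogonal (polar) factor \<open>U V\<^sup>T\<close> of \<open>A\<close>. The factor
  exists and does not depend on the decomposition, so this relation is the graph of a function.
\<close>

definition is_polar_factor :: "real ^ 'n ^ 'm \<Rightarrow> real ^ 'n ^ 'm \<Rightarrow> bool" where
  "is_polar_factor A P \<longleftrightarrow>
     (if A = 0 then P = 0
      else \<exists>u s v. compact_svd A u s v \<and> P = (\<chi> i j. \<Sum>k<rank A. u k $ i * v k $ j))"

text \<open>
  A step-size rule maps, at each time \<open>t\<close>, the list of the \<open>t + 1\<close> subgradients seen so far to a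
  nonnegative number; its values on lists of any other length are irrelevant.
\<close>

definition adaptive_step_size_rule :: "(nat \<Rightarrow> 'a list \<Rightarrow> real) \<Rightarrow> bool" where
  "adaptive_step_size_rule \<phi> \<longleftrightarrow> (\<forall>t gs. length gs = t + 1 \<longrightarrow> \<phi> t gs \<ge> 0)"

definition muon_sequence ::
    "(real ^ 'n ^ 'm \<Rightarrow> real) \<Rightarrow> real \<Rightarrow> (nat \<Rightarrow> (real ^ 'n ^ 'm) list \<Rightarrow> real) \<Rightarrow>
     (nat \<Rightarrow> real ^ 'n ^ 'm) \<Rightarrow> bool" where
  "muon_sequence f \<beta> \<phi> W \<longleftrightarrow>
     (\<exists>G M P \<eta>.
        M 0 = G 0 \<and>
        (\<forall>t. G t \<in> subdifferential f (W t) \<and>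
             M (t + 1) = \<beta> *\<^sub>R M t + (1 - \<beta>) *\<^sub>R G t \<and>
             is_polar_factor (M (t + 1)) (P (t + 1)) \<and>
             \<eta> t = \<phi> t (map G [0..<t + 1]) \<and>
             W (t + 1) = W t - \<eta> t *\<^sub>R P (t + 1)))"

end

theory Submission
  imports Defs
begin

text \<open>
  Let \<open>x\<close>, \<open>y\<close> be two entries of \<open>W\<close> in different rows and columns, and let \<open>f\<close> be the maximum
  over \<open>z \<in> {0, 1}\<close> of \<open>(\<delta> - z) (x + y) - \<epsilon> (x - y)\<close>. It is unbounded below, but at least
  \<open>- \<epsilon> (x - y)\<close>. Off the hyperplane \<open>x + y = 0\<close> the momentum is the gradient belonging to some
  averaged \<open>z \<in> [0, 1]\<close>, with entries \<open>\<delta> - z \<mp> \<epsilon>\<close>; if \<open>\<bar>z - \<delta>\<bar> > \<epsilon>\<close> these have the same sign,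
  so the polar factor moves \<open>x\<close> and \<open>y\<close> equally, \<open>x - y\<close> is conserved, and \<open>f\<close> stays bounded
  below along the sequence. The iterates avoid the hyperplane for almost every \<open>W\<^sub>0\<close> since only
  countably many displacements of \<open>x + y\<close> can occur.

  It remains to keep \<open>z\<close> away from \<open>\<delta>\<close>. With \<open>\<delta> + \<epsilon> < 1 - \<beta>\<close>, one subgradient with \<open>z = 1\<close>
  already lifts the average above \<open>\<delta> + \<epsilon>\<close>, and once \<open>x + y > 0\<close> the subgradients have \<open>z = 0\<close>
  until the average has decayed below \<open>\<delta>\<close>. So the averages that could meet \<open>\<delta>\<close> are
  \<open>\<beta>\<^sup>k (c + e)\<close> with \<open>c = 1\<close> or \<open>c = 1 - \<beta>\<^sup>n\<close> and \<open>0 \<le> e \<le> \<delta>\<close>. The unperturbed values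
  \<open>\<beta>\<^sup>k c\<close> form, up to powers of \<open>\<beta>\<close>, a finite set in each compact part of \<open>(\<beta>, 1)\<close>; a
  \<open>\<delta>\<close> equal to a high power of \<open>\<beta>\<close> times a point off this set makes \<open>e\<close> negligible.
\<close>

section \<open>Entries of the polar factor\<close>

lemma compact_svd_mult_right:
  fixes A :: "real ^ 'n::finite ^ 'm::finite"
  assumes "compact_svd A u s v" "k < rank A"
  shows "(\<Sum>j\<in>UNIV. A $ i $ j * v k $ j) = s k * u k $ i"
proof -
  have A: "A $ i $ j = (\<Sum>l<rank A. u l $ i * s l * v l $ j)" for j
    using assms(1) unfolding compact_svd_def by (metis (lifting) vec_lambda_beta)
  have v: "v l \<bullet> v k = (if k = l then 1 else 0)" if "l < rank A" for l
    using assms that unfolding compact_svd_def by auto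
  have "(\<Sum>j\<in>UNIV. A $ i $ j * v k $ j) = (\<Sum>l<rank A. u l $ i * s l * (v l \<bullet> v k))"
    unfolding A inner_vec_def sum_distrib_left sum_distrib_right
    by (subst sum.swap) (simp add: mult.assoc)
  also have "\<dots> = (\<Sum>l<rank A. if k = l then u l $ i * s l else 0)"
    by (rule sum.cong) (auto simp: v)
  also have "\<dots> = s k * u k $ i"
    using assms(2) by simp
  finally show ?thesis .
qed

lemma compact_svd_mult_left:
  fixes A :: "real ^ 'n::finite ^ 'm::finite"
  assumes "compact_svd A u s v" "k < rank A"
  shows "(\<Sum>i\<in>UNIV. A $ i $ j * u k $ i) = s k * v k $ j"
proof -
  have A: "A $ i $ j = (\<Sum>l<rank A. u l $ i * s l * v l $ j)" for i
    using assms(1) unfolding compact_svd_def by (metis (lifting) vec_lambda_beta)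
  have u: "u l \<bullet> u k = (if k = l then 1 else 0)" if "l < rank A" for l
    using assms that unfolding compact_svd_def by auto
  have "(\<Sum>i\<in>UNIV. A $ i $ j * u k $ i) = (\<Sum>l<rank A. s l * v l $ j * (u l \<bullet> u k))"
    unfolding A inner_vec_def sum_distrib_left sum_distrib_right
    by (subst sum.swap) (simp add: mult_ac)
  also have "\<dots> = (\<Sum>l<rank A. if k = l then s l * v l $ j else 0)"
    by (rule sum.cong) (auto simp: u)
  also have "\<dots> = s k * v k $ j"
    using assms(2) by simp
  finally show ?thesis .
qed

text \<open>An entry \<open>p\<close> alone in its row and column gives
  \<open>s k * u k $ i = p * v k $ j\<close> and \<open>s k * v k $ j = p * u k $ i\<close>. Hence
  \<open>s k\<close> is the absolute value of \<open>p\<close> wherever \<open>u k $ i\<close> is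
  nonzero, and \<open>p\<close> is that value times the polar entry.\<close>

lemma polar_factor_isolated_entry:
  fixes A :: "real ^ 'n::finite ^ 'm::finite"
  assumes P: "is_polar_factor A P" and nz: "A $ i $ j \<noteq> 0"
    and row: "\<And>j'. j' \<noteq> j \<Longrightarrow> A $ i $ j' = 0"
    and col: "\<And>i'. i' \<noteq> i \<Longrightarrow> A $ i' $ j = 0"
  shows "P $ i $ j = sgn (A $ i $ j)"
proof -
  have "A \<noteq> 0" using nz by auto
  then obtain u s v where svd: "compact_svd A u s v"
    and P_eq: "P = (\<chi> i j. \<Sum>k<rank A. u k $ i * v k $ j)"
    using P unfolding is_polar_factor_def by auto
  define p where "p = A $ i $ j"
  have scale: "s k * u k $ i = \<bar>p\<bar> * u k $ i" if k: "k < rank A" for k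
  proof -
    have "s k > 0" using svd k unfolding compact_svd_def by auto
    have "(\<Sum>j'\<in>UNIV. A $ i $ j' * v k $ j') = (\<Sum>j'\<in>UNIV. if j = j' then p * v k $ j else 0)"
      by (rule sum.cong) (auto simp: p_def row)
    then have u: "s k * u k $ i = p * v k $ j"
      using compact_svd_mult_right[OF svd k, of i] by simp
    have "(\<Sum>i'\<in>UNIV. A $ i' $ j * u k $ i') = (\<Sum>i'\<in>UNIV. if i = i' then p * u k $ i else 0)"
      by (rule sum.cong) (auto simp: p_def col)
    then have v: "s k * v k $ j = p * u k $ i"
      using compact_svd_mult_left[OF svd k, of j] by simp
    have "s k * (s k * u k $ i) = p * (s k * v k $ j)" unfolding u by simp
    also have "\<dots> = p * (p * u k $ i)" unfolding v ..
    finally have "((s k)\<^sup>2 - \<bar>p\<bar>\<^sup>2) * u k $ i = 0" by (simp add: power2_eq_square algebra_simps)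
    then have "(s k)\<^sup>2 = \<bar>p\<bar>\<^sup>2 \<or> u k $ i = 0" by auto
    then show ?thesis using \<open>s k > 0\<close> by (auto simp: power2_eq_iff)
  qed
  have "p = (\<Sum>k<rank A. u k $ i * s k * v k $ j)"
    using svd unfolding compact_svd_def p_def by (metis (lifting) vec_lambda_beta)
  also have "\<dots> = (\<Sum>k<rank A. \<bar>p\<bar> * (u k $ i * v k $ j))"
    by (rule sum.cong) (auto simp: scale mult.commute[of "u _ $ i"])
  also have "\<dots> = \<bar>p\<bar> * P $ i $ j"
    by (simp add: P_eq sum_distrib_left)
  finally have "p = \<bar>p\<bar> * P $ i $ j" .
  moreover have "p = \<bar>p\<bar> * sgn p" by (simp add: abs_mult_sgn)
  ultimately have "\<bar>p\<bar> * P $ i $ j = \<bar>p\<bar> * sgn p" by metis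
  then show ?thesis using nz unfolding p_def by simp
qed

section \<open>The maximum of two linear functionals\<close>

lemma convex_on_max_inner:
  fixes a b :: "'a::real_inner"
  shows "convex_on UNIV (\<lambda>x. max (a \<bullet> x) (b \<bullet> x))"
proof (rule convex_onI)
  fix t :: real and x y :: 'a
  assume t: "0 < t" "t < 1"
  have "(1 - t) * (c \<bullet> x) + t * (c \<bullet> y)
      \<le> (1 - t) * max (a \<bullet> x) (b \<bullet> x) + t * max (a \<bullet> y) (b \<bullet> y)" if "c \<in> {a, b}" for c
    using t that by (intro add_mono mult_left_mono) auto
  then show "max (a \<bullet> ((1 - t) *\<^sub>R x + t *\<^sub>R y)) (b \<bullet> ((1 - t) *\<^sub>R x + t *\<^sub>R y))
      \<le> (1 - t) * max (a \<bullet> x) (b \<bullet> x) + t * max (a \<bullet> y) (b \<bullet> y)"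
    by (simp add: inner_add_right)
qed auto

lemma lipschitz_on_max_inner:
  fixes a b :: "'a::real_inner"
  shows "(norm a + norm b)-lipschitz_on UNIV (\<lambda>x. max (a \<bullet> x) (b \<bullet> x))"
proof (rule lipschitz_onI)
  fix x y :: 'a
  have "\<bar>c \<bullet> x - c \<bullet> y\<bar> \<le> norm c * dist x y" for c
    using Cauchy_Schwarz_ineq2[of c "x - y"] by (simp add: inner_diff_right dist_norm)
  from this[of a] this[of b]
  show "dist (max (a \<bullet> x) (b \<bullet> x)) (max (a \<bullet> y) (b \<bullet> y)) \<le> (norm a + norm b) * dist x y"
    using mult_nonneg_nonneg[OF norm_ge_zero[of a] zero_le_dist[of x y]]
      mult_nonneg_nonneg[OF norm_ge_zero[of b] zero_le_dist[of x y]]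
    unfolding dist_real_def distrib_right by linarith
qed simp

text \<open>A short move from \<open>x\<close> along \<open>g - a\<close> leaves the piece
  \<open>a\<close> maximal, so the subgradient inequality forces \<open>g - a\<close> to
  vanish.\<close>

lemma subdifferential_max_inner:
  fixes a b :: "'a::real_inner"
  assumes g: "g \<in> subdifferential (\<lambda>x. max (a \<bullet> x) (b \<bullet> x)) x" and less: "b \<bullet> x < a \<bullet> x"
  shows "g = a"
proof (rule ccontr)
  assume "g \<noteq> a"
  define h where "h = g - a"
  \<comment> \<open>So small that \<open>b\<close> cannot overtake \<open>a\<close>; the added 1
    keeps the denominator positive.\<close>
  define r where "r = (a \<bullet> x - b \<bullet> x) / (1 + \<bar>(b - a) \<bullet> h\<bar>)"
  have "r > 0" using less by (simp add: r_def)
  have "r * ((b - a) \<bullet> h) \<le> r * (1 + \<bar>(b - a) \<bullet> h\<bar>)"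
    using \<open>r > 0\<close> by (intro mult_left_mono) auto
  also have "\<dots> = a \<bullet> x - b \<bullet> x" by (simp add: r_def)
  finally have "b \<bullet> (x + r *\<^sub>R h) \<le> a \<bullet> (x + r *\<^sub>R h)"
    by (simp add: inner_add_right inner_diff_left algebra_simps)
  moreover have "max (a \<bullet> (x + r *\<^sub>R h)) (b \<bullet> (x + r *\<^sub>R h)) \<ge> max (a \<bullet> x) (b \<bullet> x) + g \<bullet> (r *\<^sub>R h)"
    using g unfolding subdifferential_def by (smt (verit) add_diff_cancel_left' mem_Collect_eq)
  ultimately have "r * (h \<bullet> h) \<le> 0"
    using less by (simp add: h_def inner_add_right inner_diff_left algebra_simps)
  moreover have "0 < r * (h \<bullet> h)"
    using \<open>r > 0\<close> \<open>g \<noteq> a\<close> by (simp add: h_def)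
  ultimately show False by simp
qed

section \<open>A threshold away from all reachable momentum weights\<close>

text \<open>Weights reached by consecutive subgradients with \<open>z = 1\<close>: a run of length
  \<open>n\<close> from weight 0 gives \<open>1 - \<beta> ^ n\<close>, and a run from time 0 stays
  at 1 because \<open>M 0 = G 0\<close>.\<close>

definition run_limits :: "real \<Rightarrow> real set" where
  "run_limits \<beta> = insert 1 {1 - \<beta> ^ n | n. n \<ge> 1}"

lemma run_limits_bounds:
  assumes "0 \<le> \<beta>" "\<beta> < 1" "c \<in> run_limits \<beta>"
  shows "1 - \<beta> \<le> c" "c \<le> 1"
proof -
  have "\<beta> ^ n \<le> \<beta>" if "n \<ge> 1" for n
    using power_decreasing[of 1 n \<beta>] assms that by simp
  then show "1 - \<beta> \<le> c" "c \<le> 1"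
    using assms unfolding run_limits_def by auto
qed

lemma run_limits_step:
  assumes "c \<in> run_limits \<beta>"
  shows "\<beta> * c + (1 - \<beta>) \<in> run_limits \<beta>"
proof (cases "c = 1")
  case False
  then obtain n where n: "n \<ge> 1" "c = 1 - \<beta> ^ n"
    using assms unfolding run_limits_def by auto
  then have "\<beta> * c + (1 - \<beta>) = 1 - \<beta> ^ Suc n"
    by (simp only: power_Suc) (simp add: algebra_simps)
  then show ?thesis unfolding run_limits_def by force
qed (simp add: run_limits_def)

text \<open>The bound on \<open>\<beta> ^ i\<close> leaves finitely many \<open>i\<close>. Limits
  near 1 exceed \<open>\<beta> ^ i * \<delta>\<close> by a margin and the others have bounded
  \<open>n\<close>, so \<delta> has finitely many quotients to avoid. The factor 2 leaves room for a
  perturbation.\<close>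

lemma run_limits_gap:
  fixes \<beta> :: real
  assumes "0 < \<beta>" "\<beta> < 1"
  obtains \<delta> \<epsilon> where "0 < \<epsilon>" "\<beta> + 2 * \<epsilon> < \<delta>" "\<delta> + \<epsilon> \<le> 1"
    "\<And>i c. 1 - \<beta> \<le> \<beta> ^ i \<Longrightarrow> c \<in> run_limits \<beta> \<Longrightarrow> 2 * \<epsilon> * \<beta> ^ i < \<bar>c - \<beta> ^ i * \<delta>\<bar>"
proof -
  obtain I where I: "\<beta> ^ I < 1 - \<beta>"
    using real_arch_pow_inv[of "1 - \<beta>" \<beta>] assms by auto
  obtain N where N: "\<beta> ^ N < (1 - \<beta>) / 4"
    using real_arch_pow_inv[of "(1 - \<beta>) / 4" \<beta>] assms by auto
  define T where "T = (\<lambda>(n, i). (1 - \<beta> ^ n) / \<beta> ^ i) ` ({..N} \<times> {..I})"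
  have "finite T" by (simp add: T_def)
  have "infinite ({\<beta><..<(1 + \<beta>) / 2} - T)"
    using \<open>finite T\<close> assms by (intro Diff_infinite_finite) auto
  then obtain \<delta> where \<delta>: "\<beta> < \<delta>" "\<delta> < (1 + \<beta>) / 2" "\<delta> \<notin> T"
    by (metis (no_types) DiffD1 DiffD2 ex_in_conv finite.emptyI greaterThanLessThan_iff)
  obtain d where "d > 0" and d: "\<And>x. x \<in> T \<Longrightarrow> d \<le> \<bar>\<delta> - x\<bar>"
    using finite_set_avoid[OF \<open>finite T\<close>, of \<delta>] \<delta>(3) unfolding dist_real_def by metis
  define m where "m = min d (min (\<delta> - \<beta>) ((1 - \<beta>) / 4))"
  have m: "0 < m" "m \<le> d" "m \<le> \<delta> - \<beta>" "m \<le> (1 - \<beta>) / 4"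
    using \<open>d > 0\<close> \<delta> assms unfolding m_def by (simp_all only: min_less_iff_conj) auto
  define \<epsilon> where "\<epsilon> = m / 3"
  have \<epsilon>: "0 < \<epsilon>" "3 * \<epsilon> \<le> d" "3 * \<epsilon> \<le> \<delta> - \<beta>" "3 * \<epsilon> \<le> (1 - \<beta>) / 4"
    using m by (auto simp: \<epsilon>_def)
  show thesis
  proof
    show "0 < \<epsilon>" "\<beta> + 2 * \<epsilon> < \<delta>" "\<delta> + \<epsilon> \<le> 1"
      using \<epsilon> \<delta>(2) by (auto simp: field_simps)
    fix i c
    assume i: "1 - \<beta> \<le> \<beta> ^ i" and c: "c \<in> run_limits \<beta>"
    have pos: "0 < \<beta> ^ i" and le1: "\<beta> ^ i \<le> 1"
      using assms by (auto intro: power_le_one)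
    have less: "\<beta> ^ i * \<delta> < (1 + \<beta>) / 2"
      using mult_left_le_one_le[of \<delta> "\<beta> ^ i"] pos le1 \<delta> assms by linarith
    have e: "2 * \<epsilon> * \<beta> ^ i \<le> 2 * \<epsilon>"
      using mult_left_mono[OF le1, of "2 * \<epsilon>"] \<epsilon> by simp
    show "2 * \<epsilon> * \<beta> ^ i < \<bar>c - \<beta> ^ i * \<delta>\<bar>"
    proof (cases "1 - (1 - \<beta>) / 4 \<le> c")
      case True
      then show ?thesis using less e \<epsilon> by argo
    next
      case False
      then obtain n where n: "c = 1 - \<beta> ^ n" "(1 - \<beta>) / 4 < \<beta> ^ n"
        using c assms unfolding run_limits_def by auto
      have "n \<le> N"
        using N n assms power_decreasing[of N n \<beta>] by linarith
      moreover have "i \<le> I"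
        using I i assms power_decreasing[of I i \<beta>] by linarith
      ultimately have "c / \<beta> ^ i \<in> T"
        unfolding T_def n by force
      then have "2 * \<epsilon> < \<bar>\<delta> - c / \<beta> ^ i\<bar>"
        using d[of "c / \<beta> ^ i"] \<epsilon> by linarith
      then have "2 * \<epsilon> * \<beta> ^ i < \<bar>\<delta> - c / \<beta> ^ i\<bar> * \<beta> ^ i"
        using pos by simp
      also have "\<dots> = \<bar>(\<delta> - c / \<beta> ^ i) * \<beta> ^ i\<bar>"
        using pos by (simp add: abs_mult)
      also have "\<dots> = \<bar>c - \<beta> ^ i * \<delta>\<bar>"
        using assms by (subst abs_minus_commute) (simp add: left_diff_distrib mult.commute[of \<delta>])
      finally show ?thesis .
    qed
  qed
qed

text \<open>The pair from \<open>run_limits_gap\<close> is scaled by a small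
  \<open>\<beta> ^ j\<close>. For \<open>k > j\<close> the decayed weight lies well below the
  threshold; for \<open>k \<le> j\<close>, division by \<open>\<beta> ^ k\<close> leads back to the
  gap at exponent \<open>j - k\<close>.\<close>

lemma threshold_exists:
  fixes \<beta> :: real
  assumes "0 \<le> \<beta>" "\<beta> < 1"
  obtains \<delta> \<epsilon> where "0 < \<epsilon>" "\<epsilon> < \<delta>" "\<delta> + \<epsilon> < 1 - \<beta>"
    "\<And>k c y. c \<in> run_limits \<beta> \<Longrightarrow> c \<le> y \<Longrightarrow> y \<le> c + \<delta> \<Longrightarrow> \<epsilon> < \<bar>\<beta> ^ k * y - \<delta>\<bar>"
proof (cases "\<beta> = 0")
  case True
  show thesis
  proof
    \<comment> \<open>The only limit is now 1, so \<open>\<beta> ^ k * y\<close> is either at least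
      1 or equal to 0.\<close>
    show "0 < (1/4::real)" "1/4 < (1/2::real)" "1/2 + 1/4 < 1 - \<beta>" using True by auto
    show "1/4 < \<bar>\<beta> ^ k * y - 1/2\<bar>"
      if "c \<in> run_limits \<beta>" "c \<le> y" "y \<le> c + 1/2" for k c y
      using that run_limits_bounds[OF assms that(1)] True by (cases k) auto
  qed
next
  case False
  then have "0 < \<beta>" using assms by simp
  obtain \<delta> \<epsilon> where \<epsilon>: "0 < \<epsilon>" and \<delta>: "\<beta> + 2 * \<epsilon> < \<delta>" "\<delta> + \<epsilon> \<le> 1"
    and gap: "\<And>i c. 1 - \<beta> \<le> \<beta> ^ i \<Longrightarrow> c \<in> run_limits \<beta> \<Longrightarrow> 2 * \<epsilon> * \<beta> ^ i < \<bar>c - \<beta> ^ i * \<delta>\<bar>"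
    by (rule run_limits_gap[OF \<open>0 < \<beta>\<close> \<open>\<beta> < 1\<close>]) (rule that)
  \<comment> \<open>Only exponents with \<open>1 - \<beta> \<le> \<beta> ^ i\<close> will matter;
    for these the perturbation, at most \<open>\<beta> ^ j\<close>, is below
    \<open>\<epsilon> * \<beta> ^ i\<close>.\<close>
  obtain j where j: "\<beta> ^ j < \<epsilon> * (1 - \<beta>)"
    using real_arch_pow_inv[of "\<epsilon> * (1 - \<beta>)" \<beta>] assms \<epsilon> by auto
  have pos: "0 < \<beta> ^ i" for i using \<open>0 < \<beta>\<close> by simp
  have \<epsilon>1: "\<epsilon> < 1" using \<delta> \<open>0 < \<beta>\<close> \<epsilon> by linarith
  have j\<epsilon>: "\<beta> ^ j < \<epsilon>" and j\<beta>: "\<beta> ^ j < 1 - \<beta>"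
    using j assms \<epsilon> \<epsilon>1 mult_left_mono[of "1 - \<beta>" 1 \<epsilon>] mult_right_mono[of \<epsilon> 1 "1 - \<beta>"]
    by (auto elim!: less_le_trans)
  show thesis
  proof
    show "0 < \<beta> ^ j * \<epsilon>" "\<beta> ^ j * \<epsilon> < \<beta> ^ j * \<delta>"
      using pos \<epsilon> \<delta> \<open>0 < \<beta>\<close> by auto
    have "\<beta> ^ j * (\<delta> + \<epsilon>) \<le> \<beta> ^ j * 1"
      using \<delta> pos by (intro mult_left_mono) (auto simp: less_imp_le)
    then show "\<beta> ^ j * \<delta> + \<beta> ^ j * \<epsilon> < 1 - \<beta>"
      using j\<beta> by (simp add: distrib_left)
    fix k c y
    assume c: "c \<in> run_limits \<beta>" and y: "c \<le> y" "y \<le> c + \<beta> ^ j * \<delta>"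
    note cb = run_limits_bounds[OF assms c]
    have "\<beta> ^ j * \<delta> \<le> \<beta> ^ j"
      using \<delta> \<epsilon> pos[of j] by (intro mult_left_le) auto
    then have yc: "y \<le> c + \<beta> ^ j" using y by simp
    show "\<beta> ^ j * \<epsilon> < \<bar>\<beta> ^ k * y - \<beta> ^ j * \<delta>\<bar>"
    proof (cases "j < k")
      case True
      then obtain i where k: "k = j + Suc i" using less_imp_Suc_add by force
      have "\<beta> ^ i \<le> 1" using assms by (intro power_le_one) auto
      then have "\<beta> * \<beta> ^ i * y \<le> \<beta> * 1 * y"
        using assms cb y by (intro mult_right_mono mult_left_mono) auto
      also have "\<dots> \<le> \<beta> * (1 + \<epsilon>)"
        using y yc j\<epsilon> cb assms by (intro mult_mono) auto
      also have "\<dots> \<le> \<beta> + \<epsilon>"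
        using mult_right_mono[of \<beta> 1 \<epsilon>] assms \<epsilon> by (simp add: algebra_simps)
      finally have "\<epsilon> < \<delta> - \<beta> ^ Suc i * y"
        using \<delta> by simp
      then have "\<beta> ^ j * \<epsilon> < \<beta> ^ j * (\<delta> - \<beta> ^ Suc i * y)"
        using pos by simp
      then show ?thesis unfolding k power_add by (simp add: algebra_simps)
    next
      case False
      then obtain i where ji: "j = k + i" using le_Suc_ex not_less by blast
      have "\<epsilon> * \<beta> ^ i < \<bar>y - \<beta> ^ i * \<delta>\<bar>"
      proof (rule ccontr)
        assume "\<not> ?thesis"
        then have le: "\<bar>y - \<beta> ^ i * \<delta>\<bar> \<le> \<epsilon> * \<beta> ^ i" by simp
        have "1 - \<beta> \<le> \<beta> ^ i * (\<delta> + \<epsilon>)"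
          using le y cb by (simp add: algebra_simps)
        also have "\<dots> \<le> \<beta> ^ i"
          using \<delta> \<epsilon> \<open>0 < \<beta>\<close> pos[of i] by (intro mult_left_le) auto
        finally have i: "1 - \<beta> \<le> \<beta> ^ i" .
        have "\<beta> ^ j \<le> \<epsilon> * \<beta> ^ i"
          using less_le_trans[OF j mult_left_mono[OF i, of \<epsilon>]] \<epsilon> by simp
        then have "\<bar>c - \<beta> ^ i * \<delta>\<bar> \<le> 2 * \<epsilon> * \<beta> ^ i"
          using le yc y by linarith
        then show False using gap[OF i c] by simp
      qed
      then have "\<beta> ^ k * (\<epsilon> * \<beta> ^ i) < \<beta> ^ k * \<bar>y - \<beta> ^ i * \<delta>\<bar>"
        using pos by simp
      also have "\<dots> = \<bar>\<beta> ^ k * (y - \<beta> ^ i * \<delta>)\<bar>"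
        using pos[of k] by (simp add: abs_mult)
      finally show ?thesis unfolding ji power_add by (simp add: algebra_simps)
    qed
  qed
qed

section \<open>An objective that traps the iterates\<close>

locale muon_trap =
  fixes \<beta> \<delta> \<epsilon> :: real and i\<^sub>1 i\<^sub>2 :: "'m::finite" and j\<^sub>1 j\<^sub>2 :: "'n::finite"
  assumes beta: "0 \<le> \<beta>" "\<beta> < 1"
    and distinct: "i\<^sub>1 \<noteq> i\<^sub>2" "j\<^sub>1 \<noteq> j\<^sub>2"
    and threshold: "0 < \<epsilon>" "\<epsilon> < \<delta>" "\<delta> + \<epsilon> < 1 - \<beta>"
    and gap: "\<And>k c y. c \<in> run_limits \<beta> \<Longrightarrow> c \<le> y \<Longrightarrow> y \<le> c + \<delta> \<Longrightarrow> \<epsilon> < \<bar>\<beta> ^ k * y - \<delta>\<bar>"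
begin

definition slope :: "real \<Rightarrow> real ^ 'n ^ 'm" where
  "slope z = (\<delta> - z - \<epsilon>) *\<^sub>R axis i\<^sub>1 (axis j\<^sub>1 1) + (\<delta> - z + \<epsilon>) *\<^sub>R axis i\<^sub>2 (axis j\<^sub>2 1)"

definition objective :: "real ^ 'n ^ 'm \<Rightarrow> real" where
  "objective X = max (slope 0 \<bullet> X) (slope 1 \<bullet> X)"

definition entry_sum :: "real ^ 'n ^ 'm \<Rightarrow> real" where
  "entry_sum X = X $ i\<^sub>1 $ j\<^sub>1 + X $ i\<^sub>2 $ j\<^sub>2"

definition entry_diff :: "real ^ 'n ^ 'm \<Rightarrow> real" where
  "entry_diff X = X $ i\<^sub>1 $ j\<^sub>1 - X $ i\<^sub>2 $ j\<^sub>2"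

text \<open>
  \<open>N\<close> is the set of times at which the subgradient is \<open>slope 1\<close>; the momentum is then
  \<open>slope (weight N t)\<close>, and \<open>offset\<close> is the total change of \<open>entry_sum\<close>. Both depend only on
  \<open>N \<inter> {..<t}\<close> (for \<open>t > 0\<close>), which leaves countably many offsets.
\<close>

primrec weight :: "nat set \<Rightarrow> nat \<Rightarrow> real" where
  "weight N 0 = of_bool (0 \<in> N)"
| "weight N (Suc t) = \<beta> * weight N t + (1 - \<beta>) * of_bool (t \<in> N)"

definition offset :: "(nat \<Rightarrow> (real ^ 'n ^ 'm) list \<Rightarrow> real) \<Rightarrow> nat set \<Rightarrow> nat \<Rightarrow> real" where
  "offset \<phi> N t = (\<Sum>\<tau><t. 2 * \<phi> \<tau> (map (\<lambda>i. slope (of_bool (i \<in> N))) [0..<\<tau> + 1])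
                            * sgn (weight N (Suc \<tau>) - \<delta>))"

text \<open>
  Invariant of \<open>z = weight N (Suc t)\<close> and \<open>b = (t \<in> N)\<close>. A run of times in \<open>N\<close> can only begin
  when the weight is in \<open>[0, \<delta>)\<close>, which confines the weight at its end to \<open>[c, c + \<delta>]\<close>; a
  run of times outside \<open>N\<close> then cannot end before the weight has dropped below \<open>\<delta>\<close>.
\<close>

definition phase :: "real \<Rightarrow> bool \<Rightarrow> bool" where
  "phase z b \<longleftrightarrow>
    (if b then \<exists>c\<in>run_limits \<beta>. c \<le> z \<and> z \<le> c + \<delta>
     else (0 \<le> z \<and> z < \<delta> - \<epsilon>) \<or>
       (\<delta> + \<epsilon> < z \<and> (\<exists>k. \<exists>c\<in>run_limits \<beta>. \<exists>y. c \<le> y \<and> y \<le> c + \<delta> \<and> z = \<beta> ^ k * y)))"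

section \<open>Evolution of the momentum weight\<close>

lemma phase_away: "phase z b \<Longrightarrow> \<epsilon> < \<bar>z - \<delta>\<bar>"
proof (cases b)
  case True
  assume "phase z b"
  then obtain c where "c \<in> run_limits \<beta>" "c \<le> z"
    using True by (auto simp: phase_def)
  then show ?thesis
    using run_limits_bounds(1)[OF beta, of c] threshold by linarith
next
  case False
  assume "phase z b"
  then show ?thesis using False threshold by (auto simp: phase_def)
qed

lemma phase_init: "phase (of_bool b) b"
  using threshold by (cases b) (simp_all add: phase_def run_limits_def)

lemma phase_run:
  assumes c: "c \<in> run_limits \<beta>" and y: "c \<le> y" "y \<le> c + \<delta>"
  shows "phase (\<beta> ^ k * y) False"
proof -
  have "0 \<le> \<beta> ^ k * y"
    using y run_limits_bounds(1)[OF beta c] beta by simp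
  then show ?thesis
    using gap[OF c y, of k] c y unfolding phase_def by (auto simp: abs_if split: if_splits)
qed

text \<open>By \<open>stay\<close>, no run begins while the weight exceeds \<delta>. Within a run
  the limit advances and the excess over it shrinks by the factor \<beta>; outside runs the weight
  only decays.\<close>

lemma phase_step:
  assumes z: "phase z b" and stay: "\<not> b \<Longrightarrow> \<delta> < z \<Longrightarrow> \<not> b'"
  shows "phase (\<beta> * z + (1 - \<beta>) * of_bool b') b'"
proof (cases b')
  case True
  show ?thesis
  proof (cases b)
    case b: True
    then obtain c where c: "c \<in> run_limits \<beta>" "c \<le> z" "z \<le> c + \<delta>"
      using z by (auto simp: phase_def)
    have "\<beta> * (z - c) \<le> 1 * (z - c)" "0 \<le> \<beta> * (z - c)"
      using c beta by (intro mult_right_mono mult_nonneg_nonneg; simp)+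
    then show ?thesis
      using run_limits_step[OF c(1)] c True
      by (auto simp: phase_def algebra_simps intro!: bexI[of _ "\<beta> * c + (1 - \<beta>)"])
  next
    case False
    then have "\<not> \<delta> < z" using stay True by blast
    then have z': "0 \<le> z" "z < \<delta>"
      using z False threshold by (auto simp: phase_def)
    \<comment> \<open>A run of length one begins; the old weight survives as the excess
      \<open>\<beta> * z\<close>.\<close>
    have "1 - \<beta> \<in> run_limits \<beta>"
      unfolding run_limits_def by (force intro: exI[of _ 1])
    moreover have "\<beta> * z \<le> 1 * z" "0 \<le> \<beta> * z"
      using z' beta by (intro mult_right_mono mult_nonneg_nonneg; simp)+
    ultimately show ?thesis
      using z' True by (auto simp: phase_def intro!: bexI[of _ "1 - \<beta>"])
  qed
next
  case False
  consider "0 \<le> z" "z < \<delta> - \<epsilon>"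
    | k c y where "c \<in> run_limits \<beta>" "c \<le> y" "y \<le> c + \<delta>" "z = \<beta> ^ k * y"
  proof (cases b)
    case True
    then show ?thesis using z that(2)[of _ z 0] by (auto simp: phase_def)
  next
    case False
    then show ?thesis using z that by (auto simp: phase_def)
  qed
  then show ?thesis
  proof cases
    case 1
    then have "\<beta> * z \<le> 1 * z" "0 \<le> \<beta> * z"
      using beta by (intro mult_right_mono mult_nonneg_nonneg; simp)+
    then show ?thesis using 1 False by (simp add: phase_def)
  next
    case 2
    then show ?thesis using phase_run[of c y "Suc k"] False by (simp add: mult.assoc)
  qed
qed

section \<open>Dependence of weights and offsets on past signs\<close>

lemma weight_cong:
  assumes "\<And>\<tau>. \<tau> \<le> t \<Longrightarrow> \<tau> \<in> N \<longleftrightarrow> \<tau> \<in> N'"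
  shows "weight N (Suc t) = weight N' (Suc t)"
  using assms
proof (induction t)
  case (Suc t)
  then have "weight N (Suc t) = weight N' (Suc t)" "Suc t \<in> N \<longleftrightarrow> Suc t \<in> N'"
    by (meson le_SucI order_refl)+
  then show ?case by (simp only: weight.simps(2)[of _ "Suc t"])
qed simp

lemma offset_cong:
  assumes "\<And>\<tau>. \<tau> < t \<Longrightarrow> \<tau> \<in> N \<longleftrightarrow> \<tau> \<in> N'"
  shows "offset \<phi> N t = offset \<phi> N' t"
  unfolding offset_def
proof (rule sum.cong[OF refl])
  fix \<tau> assume "\<tau> \<in> {..<t}"
  then have eq: "i \<in> N \<longleftrightarrow> i \<in> N'" if "i \<le> \<tau>" for i
    using assms[of i] that by simp
  have "map (\<lambda>i. slope (of_bool (i \<in> N))) [0..<\<tau> + 1] = map (\<lambda>i. slope (of_bool (i \<in> N'))) [0..<\<tau> + 1]"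
  proof (rule map_cong[OF refl])
    fix i assume "i \<in> set [0..<\<tau> + 1]"
    then have "i \<in> N \<longleftrightarrow> i \<in> N'" using eq[of i] by auto
    then show "slope (of_bool (i \<in> N)) = slope (of_bool (i \<in> N'))" by simp
  qed
  moreover have "weight N (Suc \<tau>) = weight N' (Suc \<tau>)"
    using eq by (rule weight_cong)
  ultimately show "2 * \<phi> \<tau> (map (\<lambda>i. slope (of_bool (i \<in> N))) [0..<\<tau> + 1]) * sgn (weight N (Suc \<tau>) - \<delta>)
      = 2 * \<phi> \<tau> (map (\<lambda>i. slope (of_bool (i \<in> N'))) [0..<\<tau> + 1]) * sgn (weight N' (Suc \<tau>) - \<delta>)"
    by metis
qed

section \<open>Geometry of the objective\<close>

lemma inner_slope: "slope z \<bullet> X = (\<delta> - z) * entry_sum X - \<epsilon> * entry_diff X"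
  by (simp add: slope_def entry_sum_def entry_diff_def inner_add_left inner_axis' algebra_simps)

lemma slope_average: "\<beta> *\<^sub>R slope z + (1 - \<beta>) *\<^sub>R slope z' = slope (\<beta> * z + (1 - \<beta>) * z')"
proof -
  have "\<beta> *\<^sub>R (a *\<^sub>R E + b *\<^sub>R F) + (1 - \<beta>) *\<^sub>R (a' *\<^sub>R E + b' *\<^sub>R F)
      = (\<beta> * a + (1 - \<beta>) * a') *\<^sub>R E + (\<beta> * b + (1 - \<beta>) * b') *\<^sub>R F"
    for a b a' b' and E F :: "real ^ 'n ^ 'm"
    by (simp add: algebra_simps)
  moreover have "\<beta> * (\<delta> - z - \<epsilon>) + (1 - \<beta>) * (\<delta> - z' - \<epsilon>) = \<delta> - (\<beta> * z + (1 - \<beta>) * z') - \<epsilon>"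
    "\<beta> * (\<delta> - z + \<epsilon>) + (1 - \<beta>) * (\<delta> - z' + \<epsilon>) = \<delta> - (\<beta> * z + (1 - \<beta>) * z') + \<epsilon>"
    by (simp_all add: algebra_simps)
  ultimately show ?thesis unfolding slope_def by metis
qed

lemma polar_factor_slope:
  assumes P: "is_polar_factor (slope z) P" and away: "\<epsilon> < \<bar>z - \<delta>\<bar>"
  shows "P $ i\<^sub>1 $ j\<^sub>1 = sgn (\<delta> - z)" "P $ i\<^sub>2 $ j\<^sub>2 = sgn (\<delta> - z)"
proof -
  have entry: "slope z $ i $ j = (if i = i\<^sub>1 \<and> j = j\<^sub>1 then \<delta> - z - \<epsilon> else
      if i = i\<^sub>2 \<and> j = j\<^sub>2 then \<delta> - z + \<epsilon> else 0)" for i j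
    using distinct by (auto simp: slope_def axis_def)
  have nz: "\<delta> - z - \<epsilon> \<noteq> 0" "\<delta> - z + \<epsilon> \<noteq> 0"
    using away threshold(1) by linarith+
  have "P $ i\<^sub>1 $ j\<^sub>1 = sgn (slope z $ i\<^sub>1 $ j\<^sub>1)"
    by (rule polar_factor_isolated_entry[OF P]) (use nz distinct in \<open>auto simp: entry\<close>)
  then show "P $ i\<^sub>1 $ j\<^sub>1 = sgn (\<delta> - z)"
    using away threshold(1) by (auto simp: entry sgn_if)
  have "P $ i\<^sub>2 $ j\<^sub>2 = sgn (slope z $ i\<^sub>2 $ j\<^sub>2)"
    by (rule polar_factor_isolated_entry[OF P]) (use nz distinct in \<open>auto simp: entry\<close>)
  then show "P $ i\<^sub>2 $ j\<^sub>2 = sgn (\<delta> - z)"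
    using away threshold(1) distinct by (auto simp: entry sgn_if)
qed

text \<open>The two linear pieces differ by exactly \<open>entry_sum X\<close>, whose sign decides
  which one is strictly larger.\<close>

lemma subgradient_objective:
  assumes "G \<in> subdifferential objective X" "entry_sum X \<noteq> 0"
  shows "G = slope (of_bool (entry_sum X < 0))"
proof (cases "entry_sum X < 0")
  case True
  have "objective = (\<lambda>X. max (slope 1 \<bullet> X) (slope 0 \<bullet> X))"
    by (auto simp: objective_def max.commute)
  then show ?thesis
    using subdifferential_max_inner[of G "slope 1" "slope 0" X] assms True
    by (simp add: inner_slope algebra_simps)
next
  case False
  have "objective = (\<lambda>X. max (slope 0 \<bullet> X) (slope 1 \<bullet> X))"
    by (auto simp: objective_def)
  then show ?thesis
    using subdifferential_max_inner[of G "slope 0" "slope 1" X] assms False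
    by (simp add: inner_slope algebra_simps)
qed

lemma objective_ge: "- \<epsilon> * entry_diff X \<le> objective X"
proof (cases "0 \<le> entry_sum X")
  case True
  then have "0 \<le> \<delta> * entry_sum X" using threshold by simp
  then show ?thesis by (simp add: objective_def inner_slope)
next
  case False
  then have "0 \<le> (\<delta> - 1) * entry_sum X"
    using threshold beta by (intro mult_nonpos_nonpos) auto
  then show ?thesis by (simp add: objective_def inner_slope)
qed

lemma objective_unbounded_below: "(INF X. ereal (objective X)) = -\<infinity>"
proof -
  have "\<exists>X. objective X \<le> r" for r :: real
  proof
    \<comment> \<open>Where \<open>entry_sum\<close> vanishes both pieces equal
      \<open>- \<epsilon> * entry_diff X\<close>; this \<open>c\<close> turns that into
      \<open>- \<bar>r\<bar>\<close>.\<close>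
    define c where "c = \<bar>r\<bar> / (2 * \<epsilon>)"
    define X :: "real ^ 'n ^ 'm" where
      "X = c *\<^sub>R axis i\<^sub>1 (axis j\<^sub>1 1) - c *\<^sub>R axis i\<^sub>2 (axis j\<^sub>2 1)"
    have "X $ i\<^sub>1 $ j\<^sub>1 = c" "X $ i\<^sub>2 $ j\<^sub>2 = - c"
      using distinct by (auto simp: X_def axis_def)
    then have "objective X = - \<epsilon> * (2 * c)"
      by (simp add: objective_def inner_slope entry_sum_def entry_diff_def)
    also have "\<dots> = - \<bar>r\<bar>" using threshold by (simp add: c_def)
    finally show "objective X \<le> r" by simp
  qed
  then have "(INF X. ereal (objective X)) \<le> ereal r" for r
    by (metis INF_lower2 UNIV_I ereal_less_eq(3))
  then show ?thesis by (rule ereal_bot)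
qed

section \<open>Conservation of the entry difference and the null set of ties\<close>

lemma entry_diff_invariant:
  assumes step: "adaptive_step_size_rule \<phi>" and W: "muon_sequence objective \<beta> \<phi> W"
    and no_tie: "\<And>F t. finite F \<Longrightarrow> entry_sum (W 0) + offset \<phi> F t \<noteq> 0"
  shows "entry_diff (W t) = entry_diff (W 0)"
proof -
  obtain G M P \<eta> where M0: "M 0 = G 0" and run: "\<forall>t. G t \<in> subdifferential objective (W t) \<and>
             M (t + 1) = \<beta> *\<^sub>R M t + (1 - \<beta>) *\<^sub>R G t \<and>
             is_polar_factor (M (t + 1)) (P (t + 1)) \<and>
             \<eta> t = \<phi> t (map G [0..<t + 1]) \<and>
             W (t + 1) = W t - \<eta> t *\<^sub>R P (t + 1)"
    using W unfolding muon_sequence_def by blast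
  have G: "\<And>t. G t \<in> subdifferential objective (W t)"
    and M: "\<And>t. M (Suc t) = \<beta> *\<^sub>R M t + (1 - \<beta>) *\<^sub>R G t"
    and P: "\<And>t. is_polar_factor (M (Suc t)) (P (Suc t))"
    and \<eta>: "\<And>t. \<eta> t = \<phi> t (map G [0..<t + 1])"
    and W_Suc: "\<And>t. W (Suc t) = W t - \<eta> t *\<^sub>R P (Suc t)"
    using run unfolding Suc_eq_plus1 by blast+
  have \<eta>_nonneg: "0 \<le> \<eta> t" for t
    using step unfolding adaptive_step_size_rule_def \<eta> by simp
  define N where "N = {t. entry_sum (W t) < 0}"
  \<comment> \<open>The claims need each other: the offset formula excludes a tie, which fixes the
    subgradient and then the momentum. Momentum claims start at time 1, as \<open>M 0\<close> is the
    still unidentified \<open>G 0\<close>.\<close>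
  have "entry_sum (W t) = entry_sum (W 0) + offset \<phi> N t \<and> entry_diff (W t) = entry_diff (W 0) \<and>
    (\<forall>\<tau><t. G \<tau> = slope (of_bool (\<tau> \<in> N))) \<and>
    (\<forall>r. t = Suc r \<longrightarrow> M t = slope (weight N t) \<and> phase (weight N t) (r \<in> N) \<and>
       (r \<notin> N \<longrightarrow> \<delta> < weight N t \<longrightarrow> t \<notin> N))"
  proof (induction t)
    case 0
    show ?case by (simp add: offset_def)
  next
    case (Suc t)
    \<comment> \<open>Only signs before \<open>t\<close> matter, and the set recording them is
      finite, as \<open>no_tie\<close> requires.\<close>
    have "offset \<phi> N t = offset \<phi> (N \<inter> {..<t}) t"
      by (rule offset_cong) auto
    then have nz: "entry_sum (W t) \<noteq> 0"
      using Suc no_tie[of "N \<inter> {..<t}" t] by simp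
    have Gt: "G t = slope (of_bool (t \<in> N))"
      using subgradient_objective[OF G nz] by (simp add: N_def)
    then have Gs: "\<forall>\<tau><Suc t. G \<tau> = slope (of_bool (\<tau> \<in> N))"
      using Suc by (auto simp: less_Suc_eq)
    have "M t = slope (weight N t)"
      using Suc M0 Gt by (cases t) auto
    then have MS: "M (Suc t) = slope (weight N (Suc t))"
      by (simp add: M Gt slope_average)
    have ph: "phase (weight N (Suc t)) (t \<in> N)"
    proof (cases t)
      case 0
      have "weight N (Suc 0) = of_bool (0 \<in> N)" by simp
      then show ?thesis using phase_init[of "0 \<in> N"] 0 by simp
    next
      case (Suc r)
      then show ?thesis
        using Suc.IH phase_step[of "weight N t" "r \<in> N" "t \<in> N"] by simp
    qed
    note PS = polar_factor_slope[OF P[of t, unfolded MS] phase_away[OF ph]]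
    have sgn: "sgn (\<delta> - weight N (Suc t)) = - sgn (weight N (Suc t) - \<delta>)"
      by (simp add: sgn_if)
    \<comment> \<open>Both entries move by the same amount, hence the factor 2.\<close>
    have sum: "entry_sum (W (Suc t)) = entry_sum (W t) + 2 * \<eta> t * sgn (weight N (Suc t) - \<delta>)"
      unfolding entry_sum_def W_Suc using PS sgn by (simp add: algebra_simps)
    have gs: "map G [0..<t + 1] = map (\<lambda>i. slope (of_bool (i \<in> N))) [0..<t + 1]"
      using Gs by auto
    have off: "offset \<phi> N (Suc t) = offset \<phi> N t + 2 * \<eta> t * sgn (weight N (Suc t) - \<delta>)"
      by (simp only: offset_def \<eta> gs sum.lessThan_Suc)
    have diff: "entry_diff (W (Suc t)) = entry_diff (W t)"
      unfolding entry_diff_def W_Suc using PS by simp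
    \<comment> \<open>A weight above \<delta> cannot lower \<open>entry_sum\<close>, since step
      sizes are nonnegative. This supplies \<open>stay\<close> for the next step.\<close>
    have "Suc t \<notin> N" if "t \<notin> N" "\<delta> < weight N (Suc t)"
      using that sum \<eta>_nonneg[of t] by (simp add: N_def)
    then show ?case
      using Suc sum off diff Gs MS ph by simp
  qed
  then show ?thesis by blast
qed

text \<open>Each pair of a finite set and a time contributes one hyperplane, and there are countably
  many such pairs.\<close>

lemma ties_null:
  "{X. \<exists>F t. finite F \<and> entry_sum X + offset \<phi> F t = 0} \<in> null_sets lebesgue"
proof -
  define A where "A = axis i\<^sub>1 (axis j\<^sub>1 (1::real)) + axis i\<^sub>2 (axis j\<^sub>2 1)"
  have sum: "entry_sum X = A \<bullet> X" for X
    by (simp add: A_def entry_sum_def inner_add_left inner_axis')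
  have "A $ i\<^sub>1 $ j\<^sub>1 = 1"
    using distinct by (simp add: A_def axis_def)
  then have "A \<noteq> 0" by auto
  have "countable (Collect finite \<times> UNIV :: (nat set \<times> nat) set)"
    by (intro countable_SIGMA countable_Collect_finite) auto
  then have "(\<Union>(F, t) \<in> Collect finite \<times> UNIV. {X. A \<bullet> X = - offset \<phi> F t}) \<in> null_sets lebesgue"
    using \<open>A \<noteq> 0\<close>
    by (intro null_sets_UN') (auto simp: negligible_hyperplane simp flip: negligible_iff_null_sets)
  moreover have "{X. \<exists>F t. finite F \<and> entry_sum X + offset \<phi> F t = 0}
      = (\<Union>(F, t) \<in> Collect finite \<times> UNIV. {X. A \<bullet> X = - offset \<phi> F t})"
    by (auto simp: sum add_eq_0_iff2)
  ultimately show ?thesis by simp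
qed

text \<open>The exceptional set depends on \<phi> alone, so it serves all sequences \<open>W\<close>
  at once. Outside it the conserved difference gives a finite lower bound, against an infimum of
  minus infinity.\<close>

lemma trapped:
  assumes "adaptive_step_size_rule \<phi>"
  shows "AE W0 in lebesgue. \<forall>W. W 0 = W0 \<and> muon_sequence objective \<beta> \<phi> W \<longrightarrow>
    (INF t. ereal (objective (W t))) > (INF X. ereal (objective X))"
  using AE_not_in[OF ties_null[of \<phi>]]
proof (rule eventually_mono, intro allI impI)
  fix W0 W
  assume tie: "W0 \<notin> {X. \<exists>F t. finite F \<and> entry_sum X + offset \<phi> F t = 0}"
    and W: "W 0 = W0 \<and> muon_sequence objective \<beta> \<phi> W"
  have "entry_diff (W t) = entry_diff W0" for t
    using entry_diff_invariant[OF assms, of W t] W tie by auto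
  then have "ereal (- \<epsilon> * entry_diff W0) \<le> ereal (objective (W t))" for t
    using objective_ge[of "W t"] by simp
  then have "ereal (- \<epsilon> * entry_diff W0) \<le> (INF t. ereal (objective (W t)))"
    by (rule INF_greatest)
  then show "(INF X. ereal (objective X)) < (INF t. ereal (objective (W t)))"
    unfolding objective_unbounded_below
    by (rule less_le_trans[rotated]) simp
qed

end

theorem theorem3p1:
  fixes \<beta> :: real
  assumes "CARD('m::finite) \<ge> 2" and "CARD('n::finite) \<ge> 2"
    and "0 \<le> \<beta>" and "\<beta> < 1"
  shows "\<exists>f :: real ^ 'n ^ 'm \<Rightarrow> real.
    convex_on UNIV f \<and> (\<exists>L. L-lipschitz_on UNIV f) \<and>
    (\<forall>\<phi> :: nat \<Rightarrow> (real ^ 'n ^ 'm) list \<Rightarrow> real. adaptive_step_size_rule \<phi> \<longrightarrow>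
      (AE W0 in lebesgue. \<forall>W. W 0 = W0 \<and> muon_sequence f \<beta> \<phi> W \<longrightarrow>
        (INF t. ereal (f (W t))) > (INF X. ereal (f X))))"
proof -
  obtain i\<^sub>1 i\<^sub>2 :: 'm where i: "i\<^sub>1 \<noteq> i\<^sub>2"
    using assms(1) card_le_Suc0_iff_eq[of "UNIV :: 'm set"] by auto
  obtain j\<^sub>1 j\<^sub>2 :: 'n where j: "j\<^sub>1 \<noteq> j\<^sub>2"
    using assms(2) card_le_Suc0_iff_eq[of "UNIV :: 'n set"] by auto
  obtain \<delta> \<epsilon> where "muon_trap \<beta> \<delta> \<epsilon> i\<^sub>1 i\<^sub>2 j\<^sub>1 j\<^sub>2"
    using threshold_exists[OF assms(3,4)] i j assms(3,4) by (metis (no_types, lifting) muon_trap.intro)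
  then interpret muon_trap \<beta> \<delta> \<epsilon> i\<^sub>1 i\<^sub>2 j\<^sub>1 j\<^sub>2 .
  have "convex_on UNIV objective" "\<exists>L. L-lipschitz_on UNIV objective"
    unfolding objective_def[abs_def] using convex_on_max_inner lipschitz_on_max_inner by blast+
  then show ?thesis using trapped by blast
qed

end
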